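(* Suppose that $(F_k,G_k|H_k)$ is uniformly detectable and that $F_k$ and $G_k$ are uniformly bounded with an upper bound $M>0$ (i.e. $\|F_k\|\le M$, $\|G_k\|\le M$ for all $k\ge 0$). If there is a bounded nonnegative definite symmetric matrix sequence $\{P_k\}_{k\ge0}$ solving the generalized Lyapunov equation $$-P_k+F_k^TP_{k+1}F_k+G_k^TP_{k+1}G_k+H_k^TH_k=0,\qquad k=0,1,2,\dots,$$ then the system $x_{k+1}=F_kx_k+G_kx_kw_k$, $y_k=H_kx_k$ is ESMS.
   Context: $\{w_k\}_{k\ge 0}$ is a one-dimensional independent white noise process on a probability space, with $E w_k=0$, $E[w_kw_j]=\delta_{kj}$; $\mathcal F_k=\sigma(w_0,\dots,w_k)$ and $\mathcal F_{-1}$ is the trivial sigma-algebra; $l^2_{\mathcal F_k}$ is the set of $\mathcal F_k$-measurable random vectors $x$ with $E\|x\|^2<\infty$. $\mathcal N_0=\{0,1,2,\dots\}$. The symbol $(F_k,G_k|H_k)$ denotes the system $x_{k+1}=F_kx_k+G_kx_kw_k$, $y_k=H_kx_k$, $k\in\mathcal N_0$, with $x_k\in\mathbb R^n$, $y_k\in\mathbb R^m$ and $F_k,G_k\in\mathbb R^{n\times n}$, $H_k\in\mathbb R^{m\times n}$ deterministic time-varying real matrices. Uniform detectability: there exist integers $s,t\ge 0$ and constants $d,b$ with $0\le d<1$ and $0<b<\infty$ such that, for every $k\in\mathcal N_0$ and every state $x_k\in l^2_{\mathcal F_{k-1}}$ at time $k$ (with $x_{k+1},\dots$ and $y_k,\dots$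 generated by the system from $x_k$), whenever $E\|x_{k+t}\|^2\ge d^2E\|x_k\|^2$ there holds $\sum_{i=k}^{k+s}E\|y_i\|^2\ge b^2E\|x_k\|^2$. ESMS (exponentially stable in mean square): there exist $\beta\ge 1$ and $\lambda\in(0,1)$ such that for any $0\le k_0\le k<+\infty$ and any state $x_{k_0}\in l^2_{\mathcal F_{k_0-1}}$ at time $k_0$, the trajectory started from $x_{k_0}$ satisfies $E\|x_k\|^2\le\beta E\|x_{k_0}\|^2\lambda^{k-k_0}$. *)

theory Defs
  imports "HOL-Probability.Probability"
begin

text \<open>
  Square integrability of the noise is not assumed separately: the Bochner integral of a
  non-integrable function is 0, so the case \<open>j = k\<close> of the covariance condition
  enforces it.
\<close>

locale white_noise = prob_space \<Omega> for \<Omega> :: "'a measure" +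
  fixes w :: "nat \<Rightarrow> 'a \<Rightarrow> real"
  assumes indep: "indep_vars (\<lambda>_. borel) w UNIV"
    and mean: "\<And>k. expectation (w k) = 0"
    and covariance: "\<And>k j. expectation (\<lambda>\<omega>. w k \<omega> * w j \<omega>) = (if k = j then 1 else 0)"

text \<open>
  The index is shifted by one: \<open>past \<Omega> w k\<close> is the sigma-algebra
  generated by \<open>w 0, \<dots>, w (k - 1)\<close>, usually written with index \<open>k - 1\<close>. For
  \<open>k = 0\<close> the generating family is empty and the sigma-algebra is trivial.
\<close>

definition past :: "'a measure \<Rightarrow> (nat \<Rightarrow> 'a \<Rightarrow> real) \<Rightarrow> nat \<Rightarrow> 'a measure" where
  "past \<Omega> w k =
     sigma (space \<Omega>) (\<Union>i<k. {w i -` A \<inter> space \<Omega> | A. A \<in> sets borel})"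

definition l2_past ::
    "'a measure \<Rightarrow> (nat \<Rightarrow> 'a \<Rightarrow> real) \<Rightarrow> nat \<Rightarrow> ('a \<Rightarrow> real^'n) set" where
  "l2_past \<Omega> w k =
     {x \<in> borel_measurable (past \<Omega> w k). integrable \<Omega> (\<lambda>\<omega>. (norm (x \<omega>))\<^sup>2)}"

definition mean_sq :: "'a measure \<Rightarrow> ('a \<Rightarrow> real^'n) \<Rightarrow> real" where
  "mean_sq \<Omega> x = (\<integral>\<omega>. (norm (x \<omega>))\<^sup>2 \<partial>\<Omega>)"

text \<open>
  \<open>state F G w k \<xi> i\<close> is the state at absolute time \<open>i\<close> of the trajectory that is
  equal to \<open>\<xi>\<close> at time \<open>k\<close>. It is meaningful for \<open>i \<ge> k\<close> only; for
  \<open>i < k\<close> it has the dummy value \<open>\<xi>\<close>.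
\<close>

primrec state ::
    "(nat \<Rightarrow> real^'n^'n) \<Rightarrow> (nat \<Rightarrow> real^'n^'n) \<Rightarrow> (nat \<Rightarrow> 'a \<Rightarrow> real) \<Rightarrow>
     nat \<Rightarrow> ('a \<Rightarrow> real^'n) \<Rightarrow> nat \<Rightarrow> 'a \<Rightarrow> real^'n" where
  "state F G w k \<xi> 0 = \<xi>"
| "state F G w k \<xi> (Suc i) =
     (if i < k then \<xi>
      else (\<lambda>\<omega>. F i *v state F G w k \<xi> i \<omega> + w i \<omega> *\<^sub>R (G i *v state F G w k \<xi> i \<omega>)))"

definition sys_output ::
    "(nat \<Rightarrow> real^'n^'n) \<Rightarrow> (nat \<Rightarrow> real^'n^'n) \<Rightarrow> (nat \<Rightarrow> real^'n^'m) \<Rightarrow> (nat \<Rightarrow> 'a \<Rightarrow> real) \<Rightarrow>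
     nat \<Rightarrow> ('a \<Rightarrow> real^'n) \<Rightarrow> nat \<Rightarrow> 'a \<Rightarrow> real^'m" where
  "sys_output F G H w k \<xi> i = (\<lambda>\<omega>. H i *v state F G w k \<xi> i \<omega>)"

definition uniformly_detectable ::
    "'a measure \<Rightarrow> (nat \<Rightarrow> 'a \<Rightarrow> real) \<Rightarrow>
     (nat \<Rightarrow> real^'n^'n) \<Rightarrow> (nat \<Rightarrow> real^'n^'n) \<Rightarrow> (nat \<Rightarrow> real^'n^'m) \<Rightarrow> bool" where
  "uniformly_detectable \<Omega> w F G H \<longleftrightarrow>
     (\<exists>(s::nat) (t::nat) (d::real) (b::real). 0 \<le> d \<and> d < 1 \<and> 0 < b \<and>
        (\<forall>k. \<forall>\<xi> \<in> l2_past \<Omega> w k.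
           mean_sq \<Omega> (state F G w k \<xi> (k + t)) \<ge> d\<^sup>2 * mean_sq \<Omega> \<xi> \<longrightarrow>
           (\<Sum>i=k..k+s. mean_sq \<Omega> (sys_output F G H w k \<xi> i)) \<ge> b\<^sup>2 * mean_sq \<Omega> \<xi>))"

definition ESMS ::
    "'a measure \<Rightarrow> (nat \<Rightarrow> 'a \<Rightarrow> real) \<Rightarrow> (nat \<Rightarrow> real^'n^'n) \<Rightarrow> (nat \<Rightarrow> real^'n^'n) \<Rightarrow> bool" where
  "ESMS \<Omega> w F G \<longleftrightarrow>
     (\<exists>(\<beta>::real) (q::real). 1 \<le> \<beta> \<and> 0 < q \<and> q < 1 \<and>
        (\<forall>k0 k. k0 \<le> k \<longrightarrow> (\<forall>\<xi> \<in> l2_past \<Omega> w k0.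
           mean_sq \<Omega> (state F G w k0 \<xi> k) \<le> \<beta> * mean_sq \<Omega> \<xi> * q ^ (k - k0))))"

definition nonneg_definite :: "real^'n^'n \<Rightarrow> bool" where
  "nonneg_definite A \<longleftrightarrow> (\<forall>x. 0 \<le> x \<bullet> (A *v x))"

end

theory Submission
  imports Defs
begin

text \<open>
  Along a trajectory let \<open>X\<close> be the mean square of the state, \<open>Y\<close> that of the output and
  \<open>V\<close> the expectation of the quadratic form of \<open>P\<close>. The proof reduces the theorem to three
  relations between these real sequences.

  The noise at time \<open>k\<close> is independent of the state at time \<open>k\<close>, centred and of unit variance, so
  in one step the cross terms of a quadratic form average to zero, and the expectation of the form
  of \<open>Q\<close> at the next state is that of \<open>F\<^sup>TQF + G\<^sup>TQG\<close> at the present one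
  (\<open>expectation_quadratic_form_step\<close>). For \<open>Q = I\<close> this bounds the growth of \<open>X\<close> by the factor
  \<open>2M\<^sup>2\<close> per step. For \<open>Q = P\<close> the Lyapunov equation turns it into the dissipation identity
  \<open>V n - V (n + 1) = Y n\<close>; since \<open>P\<close> is nonnegative and bounded, the total output energy from any
  time on is at most \<open>V n \<le> B * X n\<close>.

  Detectability offers two cases: either \<open>X (n + t) < d\<^sup>2 * X n\<close>, or \<open>X n\<close>, and hence by the growth
  bound also \<open>X (n + t)\<close>, is dominated by the output energy of the window from \<open>n\<close> to \<open>n + s\<close>. Both cases
  give the single linear inequality
  \<open>X (n + t) \<le> d\<^sup>2 * X n + c * (Y n + \<dots> + Y (n + s))\<close>.
  Summing it over \<open>n\<close>, where \<open>d\<^sup>2 < 1\<close> and the outputs have finite total energy, bounds every tail sum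
  of \<open>X\<close> by a constant multiple of its first term (\<open>tail_sums_bounded_if_detectable\<close>). A sequence
  with this property decays geometrically (\<open>decay_if_tail_sums_bounded\<close>, the discrete form of
  Datko's argument). The constants depend on the system alone, which gives the uniformity in the
  initial time and the initial state.
\<close>

section \<open>Summability along the orbit forces exponential decay\<close>

text \<open>
  A tail sum \<open>T\<close> loses its first term when it starts one step later, and that term is at least
  \<open>T / C\<close>; hence tail sums, and with them their first terms, shrink by the factor \<open>1 - 1 / C\<close>.
  Finite sums of arbitrary length stand in for the infinite series, whose convergence
  would otherwise have to be treated separately.
\<close>

lemma decay_if_tail_sums_bounded:
  fixes X :: "nat \<Rightarrow> real"
  assumes "1 \<le> C" and tail: "\<And>n N. (\<Sum>j<N. X (n + j)) \<le> C * X n"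
  shows "X n \<le> C * X 0 * (1 - 1 / C) ^ n"
proof -
  have "0 \<le> 1 - 1 / C"
    using \<open>1 \<le> C\<close> by simp
  have tail_decay: "(\<Sum>j<Suc N. X (n + j)) \<le> C * X 0 * (1 - 1 / C) ^ n" for n N
  proof (induction n arbitrary: N)
    case 0
    show ?case
      using tail[of 0 "Suc N"] by simp
  next
    case (Suc n)
    define T where "T = (\<Sum>j<Suc (Suc N). X (n + j))"
    have "T = X n + (\<Sum>j<Suc N. X (Suc n + j))"
      unfolding T_def by (subst sum.lessThan_Suc_shift) simp
    moreover have "T / C \<le> X n"
      using tail[of n "Suc (Suc N)"] \<open>1 \<le> C\<close>
      unfolding T_def[symmetric] by (simp add: pos_divide_le_eq mult.commute)
    ultimately have "(\<Sum>j<Suc N. X (Suc n + j)) \<le> (1 - 1 / C) * T"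
      unfolding left_diff_distrib by simp
    also have "\<dots> \<le> (1 - 1 / C) * (C * X 0 * (1 - 1 / C) ^ n)"
      unfolding T_def using Suc.IH \<open>0 \<le> 1 - 1 / C\<close> by (rule mult_left_mono)
    finally show ?case
      by (simp add: mult_ac)
  qed
  show ?thesis
    using tail_decay[of n 0] by simp
qed

lemma sum_shift_le:
  fixes X :: "nat \<Rightarrow> real"
  assumes nonneg: "\<And>n. 0 \<le> X n"
  shows "(\<Sum>j<N. X (n + j)) \<le> (\<Sum>j<t. X (n + j)) + (\<Sum>j<N. X (n + j + t))"
proof -
  have "(\<Sum>j<N. X (n + j)) \<le> (\<Sum>j<t + N. X (n + j))"
    using nonneg by (intro sum_mono2) auto
  also have "\<dots> = (\<Sum>j<t. X (n + j)) + (\<Sum>j<N. X (n + (t + j)))"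
    by (induction N) simp_all
  also have "(\<Sum>j<N. X (n + (t + j))) = (\<Sum>j<N. X (n + j + t))"
    by (simp add: add_ac)
  finally show ?thesis .
qed

text \<open>
  Summing \<open>detect\<close> over \<open>N\<close> consecutive times gives \<open>\<delta>\<close> times the sum to be bounded, which is
  absorbed on the left because \<open>\<delta> < 1\<close>, and \<open>s + 1\<close> shifted output sums, each of which
  telescopes to at most \<open>V n\<close>. The first \<open>t\<close> terms, which \<open>detect\<close> does not reach, are covered by
  the growth bound.
\<close>

lemma tail_sums_bounded_if_detectable:
  fixes X Y V :: "nat \<Rightarrow> real"
  assumes "\<delta> < 1" "0 \<le> c" "0 \<le> K"
    and X: "\<And>n. 0 \<le> X n" and growth: "\<And>n. X (Suc n) \<le> K * X n"
    and V: "\<And>n. 0 \<le> V n" and V_le: "\<And>n. V n \<le> B * X n"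
    and Y: "\<And>n. 0 \<le> Y n" and dissipation: "\<And>n. V n - V (Suc n) = Y n"
    and detect: "\<And>n. X (n + t) \<le> \<delta> * X n + c * (\<Sum>i\<le>s. Y (n + i))"
  shows "(\<Sum>j<N. X (n + j)) \<le> ((\<Sum>j<t. K ^ j) + c * real (Suc s) * B) / (1 - \<delta>) * X n"
proof -
  have pow: "X (n + j) \<le> K ^ j * X n" for j
  proof (induction j)
    case (Suc j)
    have "X (n + Suc j) \<le> K * X (n + j)"
      using growth[of "n + j"] by simp
    also have "\<dots> \<le> K * (K ^ j * X n)"
      using Suc \<open>0 \<le> K\<close> by (rule mult_left_mono)
    finally show ?case
      by (simp add: mult_ac)
  qed simp
  have V_mono: "V (n + i) \<le> V n" for i
  proof (induction i)
    case (Suc i)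
    then show ?case
      using dissipation[of "n + i"] Y[of "n + i"] by simp
  qed simp
  have energy: "(\<Sum>j<N. Y (n + i + j)) \<le> V n" for i
  proof -
    have "(\<Sum>j<N. Y (n + i + j)) = V (n + i) - V (n + i + N)"
      by (induction N) (auto simp flip: dissipation)
    then show ?thesis
      using V[of "n + i + N"] V_mono[of i] by simp
  qed
  have "(\<Sum>j<N. \<Sum>i\<le>s. Y (n + j + i)) = (\<Sum>i\<le>s. \<Sum>j<N. Y (n + i + j))"
    by (subst sum.swap) (simp add: add_ac)
  also have "\<dots> \<le> (\<Sum>i\<le>s. V n)"
    by (intro sum_mono energy)
  also have "\<dots> \<le> real (Suc s) * (B * X n)"
    using mult_left_mono[OF V_le[of n], of "real (Suc s)"] by simp
  finally have outputs: "(\<Sum>j<N. \<Sum>i\<le>s. Y (n + j + i)) \<le> real (Suc s) * (B * X n)" .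
  have "(\<Sum>j<N. X (n + j)) \<le> (\<Sum>j<t. X (n + j)) + (\<Sum>j<N. X (n + j + t))"
    using X by (rule sum_shift_le)
  also have "\<dots> \<le> (\<Sum>j<t. K ^ j * X n)
      + (\<Sum>j<N. \<delta> * X (n + j) + c * (\<Sum>i\<le>s. Y (n + j + i)))"
    by (intro add_mono sum_mono pow detect)
  also have "\<dots> = (\<Sum>j<t. K ^ j) * X n + \<delta> * (\<Sum>j<N. X (n + j))
      + c * (\<Sum>j<N. \<Sum>i\<le>s. Y (n + j + i))"
    by (simp add: sum.distrib sum_distrib_left sum_distrib_right)
  also have "\<dots> \<le> (\<Sum>j<t. K ^ j) * X n + \<delta> * (\<Sum>j<N. X (n + j))
      + c * (real (Suc s) * (B * X n))"
    using mult_left_mono[OF outputs \<open>0 \<le> c\<close>] by simp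
  finally have "(1 - \<delta>) * (\<Sum>j<N. X (n + j)) \<le> ((\<Sum>j<t. K ^ j) + c * real (Suc s) * B) * X n"
    by (simp add: algebra_simps)
  then show ?thesis
    using \<open>\<delta> < 1\<close> by (simp add: field_simps)
qed

section \<open>Quadratic forms\<close>

lemma inner_matrix_vector_mult_both:
  fixes A :: "real^'n^'m" and B :: "real^'k^'m"
  shows "(A *v x) \<bullet> (B *v y) = x \<bullet> ((transpose A ** B) *v y)"
  by (metis dot_lmul_matrix matrix_vector_mul_assoc vector_transpose_matrix)

lemma norm_matrix_vector_mult_le:
  fixes A :: "real^'n^'m"
  assumes "onorm ((*v) A) \<le> M"
  shows "norm (A *v x) \<le> M * norm x"
  using onorm[of "(*v) A" x] mult_right_mono[OF assms, of "norm x"] by simp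

lemma quadratic_form_le_onorm:
  fixes A :: "real^'n^'n"
  shows "\<bar>x \<bullet> (A *v x)\<bar> \<le> onorm ((*v) A) * (norm x)\<^sup>2"
proof -
  have "\<bar>x \<bullet> (A *v x)\<bar> \<le> norm x * norm (A *v x)"
    by (rule Cauchy_Schwarz_ineq2)
  also have "\<dots> \<le> norm x * (onorm ((*v) A) * norm x)"
    by (intro mult_left_mono norm_matrix_vector_mult_le) auto
  finally show ?thesis
    by (simp add: power2_eq_square mult_ac)
qed

lemma bounded_range_onorm_matrix:
  fixes P :: "nat \<Rightarrow> real^'n^'m"
  assumes "bounded (range P)"
  obtains B where "\<And>k. onorm ((*v) (P k)) \<le> B"
proof -
  obtain b where b: "\<And>k. norm (P k) \<le> b"
    using assms by (auto simp: bounded_iff)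
  have "\<bar>P k $ i $ j\<bar> \<le> b" for k i j
    using component_le_norm_cart[of "P k $ i" j] Finite_Cartesian_Product.norm_nth_le[of "P k" i] b[of k]
    by linarith
  then have "\<And>k. onorm ((*v) (P k)) \<le> real CARD('m) * real CARD('n) * b"
    by (rule onorm_le_matrix_component)
  then show thesis
    by (rule that)
qed

lemma borel_measurable_matrix_vector_mult [measurable]:
  fixes A :: "real^'n^'m"
  shows "(*v) A \<in> borel_measurable borel"
  by (intro borel_measurable_continuous_onI linear_continuous_on matrix_vector_mul_bounded_linear)

section \<open>White noise and the second moments of the system\<close>

lemma state_initial [simp]: "state F G w k \<xi> k = \<xi>"
  by (cases k) auto

text \<open>
  Detectability is a statement about trajectories at their starting time. To use it at a later time
  of a given trajectory, the trajectory is regarded as started anew there.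
\<close>

lemma state_restart:
  "state F G w (k + m) (state F G w k \<xi> (k + m)) (k + m + n) = state F G w k \<xi> (k + m + n)"
  by (induction n) simp_all

context white_noise
begin

lemma space_past [simp]: "space (past \<Omega> w k) = space \<Omega>"
  by (auto simp: past_def intro!: space_measure_of)

lemma sets_past:
  "sets (past \<Omega> w k) =
     sigma_sets (space \<Omega>) (\<Union>i<k. {w i -` A \<inter> space \<Omega> | A. A \<in> sets borel})"
  by (auto simp: past_def intro!: sets_measure_of)

lemma noise_measurable [measurable]: "w k \<in> borel_measurable \<Omega>"
  using indep by (auto simp: indep_vars_def)

lemma noise_measurable_past: "i < k \<Longrightarrow> w i \<in> borel_measurable (past \<Omega> w k)"
  by (auto simp: measurable_def sets_past intro!: sigma_sets.Basic)

lemma sets_past_subset: "sets (past \<Omega> w k) \<subseteq> sets \<Omega>"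
  unfolding sets_past by (rule sets.sigma_sets_subset) auto

lemma measurable_pastD: "f \<in> measurable (past \<Omega> w k) N \<Longrightarrow> f \<in> measurable \<Omega> N"
  using sets_past_subset by (auto simp: measurable_def)

lemma measurable_past_mono:
  assumes "f \<in> measurable (past \<Omega> w k) N" and "k \<le> l"
  shows "f \<in> measurable (past \<Omega> w l) N"
proof -
  have "sets (past \<Omega> w k) \<subseteq> sets (past \<Omega> w l)"
    unfolding sets_past using \<open>k \<le> l\<close> by (intro sigma_sets_mono' UN_mono) auto
  then show ?thesis
    using assms(1) by (auto simp: measurable_def)
qed

text \<open>
  The past and the present noise are generated by disjoint blocks of an independent family, and
  generated sigma-algebras inherit the independence. The function \<open>g\<close> allows both the noise and
  its square as the second variable.
\<close>

lemma indep_past_noise: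
  fixes g :: "real \<Rightarrow> real"
  assumes f: "f \<in> borel_measurable (past \<Omega> w k)"
    and g: "g \<in> borel_measurable borel"
  shows "indep_var borel f borel (\<lambda>\<omega>. g (w k \<omega>))"
proof -
  define E where "E i = {w i -` A \<inter> space \<Omega> | A. A \<in> sets borel}" for i
  have "indep_sets E UNIV"
    using indep unfolding indep_vars_def2 E_def by simp
  have "indep_sets (\<lambda>j. sigma_sets (space \<Omega>) (\<Union>i\<in>(case j of True \<Rightarrow> {..<k} | False \<Rightarrow> {k}). E i)) UNIV"
  proof (rule indep_sets_collect_sigma)
    show "indep_sets E (\<Union>j\<in>UNIV. case j of True \<Rightarrow> {..<k} | False \<Rightarrow> {k})"
      using \<open>indep_sets E UNIV\<close> by (rule indep_sets_mono_index[rotated]) simp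
    show "Int_stable (E i)" for i
    proof (rule Int_stableI)
      fix a b assume "a \<in> E i" "b \<in> E i"
      then obtain A B where "a = w i -` A \<inter> space \<Omega>" "A \<in> sets borel"
        "b = w i -` B \<inter> space \<Omega>" "B \<in> sets borel"
        by (auto simp: E_def)
      then show "a \<inter> b \<in> E i"
        unfolding E_def by (intro CollectI exI[of _ "A \<inter> B"]) auto
    qed
    show "disjoint_family (case_bool {..<k} {k})"
      by (auto simp: disjoint_family_on_def split: bool.split)
  qed
  then have "indep_set (sets (past \<Omega> w k)) (sigma_sets (space \<Omega>) (E k))"
    unfolding indep_set_def
    by (rule indep_sets_mono_sets) (auto simp: sets_past E_def split: bool.split)
  moreover have "sigma_sets (space \<Omega>) {f -` A \<inter> space \<Omega> | A. A \<in> sets borel} \<subseteq> sets (past \<Omega> w k)"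
    using measurable_sets[OF f] sets.sigma_sets_subset[of "{f -` A \<inter> space \<Omega> | A. A \<in> sets borel}" "past \<Omega> w k"]
    by auto
  moreover have "sigma_sets (space \<Omega>) {(\<lambda>\<omega>. g (w k \<omega>)) -` A \<inter> space \<Omega> | A. A \<in> sets borel}
      \<subseteq> sigma_sets (space \<Omega>) (E k)"
  proof (intro sigma_sets_mono', clarify)
    fix A :: "real set" assume "A \<in> sets borel"
    then have "g -` A \<in> sets borel"
      using measurable_sets[OF g] by simp
    then show "(\<lambda>\<omega>. g (w k \<omega>)) -` A \<inter> space \<Omega> \<in> E k"
      unfolding E_def by (intro CollectI exI[of _ "g -` A"]) auto
  qed
  ultimately have "indep_set (sigma_sets (space \<Omega>) {f -` A \<inter> space \<Omega> | A. A \<in> sets borel})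
      (sigma_sets (space \<Omega>) {(\<lambda>\<omega>. g (w k \<omega>)) -` A \<inter> space \<Omega> | A. A \<in> sets borel})"
    unfolding indep_sets2_eq by (meson subset_trans subsetD)
  then show ?thesis
    using measurable_pastD[OF f] g by (simp add: indep_var_eq)
qed

text \<open>
  A function that is not integrable has Bochner integral 0, while the variance of the noise is 1.
\<close>

lemma integrable_noise_square: "integrable \<Omega> (\<lambda>\<omega>. (w k \<omega>)\<^sup>2)"
  using covariance[of k k] not_integrable_integral_eq[of \<Omega> "\<lambda>\<omega>. (w k \<omega>)\<^sup>2"]
  by (auto simp: power2_eq_square)

lemma expectation_noise_square: "expectation (\<lambda>\<omega>. (w k \<omega>)\<^sup>2) = 1"
  using covariance[of k k] by (simp add: power2_eq_square)

lemma integrable_noise: "integrable \<Omega> (w k)"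
  by (rule square_integrable_imp_integrable[OF noise_measurable integrable_noise_square])

lemma
  fixes f :: "'a \<Rightarrow> real"
  assumes f: "f \<in> borel_measurable (past \<Omega> w k)" "integrable \<Omega> f"
  shows integrable_past_noise: "integrable \<Omega> (\<lambda>\<omega>. f \<omega> * w k \<omega>)"
    and expectation_past_noise: "expectation (\<lambda>\<omega>. f \<omega> * w k \<omega>) = 0"
    and integrable_past_noise_square: "integrable \<Omega> (\<lambda>\<omega>. f \<omega> * (w k \<omega>)\<^sup>2)"
    and expectation_past_noise_square: "expectation (\<lambda>\<omega>. f \<omega> * (w k \<omega>)\<^sup>2) = expectation f"
proof -
  note ind1 = indep_past_noise[OF f(1), of "\<lambda>u. u", simplified]
    and ind2 = indep_past_noise[OF f(1), of "\<lambda>u. u\<^sup>2", simplified]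
  show "integrable \<Omega> (\<lambda>\<omega>. f \<omega> * w k \<omega>)"
    by (rule indep_var_integrable[OF ind1 f(2) integrable_noise])
  show "expectation (\<lambda>\<omega>. f \<omega> * w k \<omega>) = 0"
    using indep_var_lebesgue_integral[OF ind1 f(2) integrable_noise] mean by simp
  show "integrable \<Omega> (\<lambda>\<omega>. f \<omega> * (w k \<omega>)\<^sup>2)"
    by (rule indep_var_integrable[OF ind2 f(2) integrable_noise_square])
  show "expectation (\<lambda>\<omega>. f \<omega> * (w k \<omega>)\<^sup>2) = expectation f"
    using indep_var_lebesgue_integral[OF ind2 f(2) integrable_noise_square]
    by (simp only: expectation_noise_square mult_1_right)
qed

lemma
  fixes A :: "real^'n^'n"
  assumes "x \<in> l2_past \<Omega> w k"
  shows quadratic_form_measurable_past: "(\<lambda>\<omega>. x \<omega> \<bullet> (A *v x \<omega>)) \<in> borel_measurable (past \<Omega> w k)"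
    and integrable_quadratic_form: "integrable \<Omega> (\<lambda>\<omega>. x \<omega> \<bullet> (A *v x \<omega>))"
proof -
  have [measurable]: "x \<in> borel_measurable (past \<Omega> w k)"
    and sq: "integrable \<Omega> (\<lambda>\<omega>. (norm (x \<omega>))\<^sup>2)"
    using assms by (auto simp: l2_past_def)
  show meas: "(\<lambda>\<omega>. x \<omega> \<bullet> (A *v x \<omega>)) \<in> borel_measurable (past \<Omega> w k)"
    by measurable
  show "integrable \<Omega> (\<lambda>\<omega>. x \<omega> \<bullet> (A *v x \<omega>))"
  proof (rule Bochner_Integration.integrable_bound)
    show "integrable \<Omega> (\<lambda>\<omega>. onorm ((*v) A) * (norm (x \<omega>))\<^sup>2)"
      using sq by simp
    show "AE \<omega> in \<Omega>. norm (x \<omega> \<bullet> (A *v x \<omega>)) \<le> norm (onorm ((*v) A) * (norm (x \<omega>))\<^sup>2)"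
      unfolding real_norm_def
      by (rule AE_I2) (rule order_trans[OF quadratic_form_le_onorm abs_ge_self])
  qed (rule measurable_pastD[OF meas])
qed

text \<open>
  The form of \<open>Q\<close> at the next state is a polynomial of degree 2 in the noise whose coefficients are
  quadratic forms of the present state and hence depend on the past only. Independence replaces the
  noise by its mean 0 and its square by the variance 1.
\<close>

lemma
  fixes A B Q :: "real^'n^'n"
  assumes x: "x \<in> l2_past \<Omega> w k"
  defines "x' \<equiv> (\<lambda>\<omega>. A *v x \<omega> + w k \<omega> *\<^sub>R (B *v x \<omega>))"
  shows integrable_quadratic_form_step: "integrable \<Omega> (\<lambda>\<omega>. x' \<omega> \<bullet> (Q *v x' \<omega>))"
    and expectation_quadratic_form_step: "expectation (\<lambda>\<omega>. x' \<omega> \<bullet> (Q *v x' \<omega>)) =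
      expectation (\<lambda>\<omega>. x \<omega> \<bullet> ((transpose A ** Q ** A + transpose B ** Q ** B) *v x \<omega>))"
proof -
  let ?q = "\<lambda>S \<omega>. x \<omega> \<bullet> (S *v x \<omega>)"
  let ?cross = "transpose A ** Q ** B + transpose B ** Q ** A"
  note int = integrable_quadratic_form[OF x] and meas = quadratic_form_measurable_past[OF x]
  have expand: "(\<lambda>\<omega>. x' \<omega> \<bullet> (Q *v x' \<omega>)) = (\<lambda>\<omega>. ?q (transpose A ** Q ** A) \<omega>
      + ?q ?cross \<omega> * w k \<omega> + ?q (transpose B ** Q ** B) \<omega> * (w k \<omega>)\<^sup>2)"
  proof
    fix \<omega>
    let ?a = "A *v x \<omega>" and ?b = "B *v x \<omega>"
    have q: "(S *v x \<omega>) \<bullet> (Q *v (T *v x \<omega>)) = ?q (transpose S ** Q ** T) \<omega>" for S T :: "real^'n^'n"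
      by (simp add: matrix_vector_mul_assoc inner_matrix_vector_mult_both matrix_mul_assoc)
    have "x' \<omega> \<bullet> (Q *v x' \<omega>) = ?a \<bullet> (Q *v ?a)
        + (?a \<bullet> (Q *v ?b) + ?b \<bullet> (Q *v ?a)) * w k \<omega> + ?b \<bullet> (Q *v ?b) * (w k \<omega>)\<^sup>2"
      unfolding x'_def matrix_vector_right_distrib matrix_vector_mult_scaleR
      by (simp add: inner_add_left inner_add_right power2_eq_square distrib_left distrib_right mult_ac)
    then show "x' \<omega> \<bullet> (Q *v x' \<omega>) = ?q (transpose A ** Q ** A) \<omega>
      + ?q ?cross \<omega> * w k \<omega> + ?q (transpose B ** Q ** B) \<omega> * (w k \<omega>)\<^sup>2"
      unfolding q by (simp only: matrix_vector_mult_add_rdistrib inner_add_right)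
  qed
  show "integrable \<Omega> (\<lambda>\<omega>. x' \<omega> \<bullet> (Q *v x' \<omega>))"
    unfolding expand
    by (intro Bochner_Integration.integrable_add int integrable_past_noise
        integrable_past_noise_square meas)
  show "expectation (\<lambda>\<omega>. x' \<omega> \<bullet> (Q *v x' \<omega>)) =
      expectation (\<lambda>\<omega>. x \<omega> \<bullet> ((transpose A ** Q ** A + transpose B ** Q ** B) *v x \<omega>))"
    unfolding expand
    by (simp add: matrix_vector_mult_add_rdistrib[of "transpose A ** Q ** A"] inner_add_right
        int meas integrable_past_noise integrable_past_noise_square
        expectation_past_noise expectation_past_noise_square)
qed

lemma l2_past_step:
  fixes A B :: "real^'n^'n"
  assumes x: "x \<in> l2_past \<Omega> w k"
  shows "(\<lambda>\<omega>. A *v x \<omega> + w k \<omega> *\<^sub>R (B *v x \<omega>)) \<in> l2_past \<Omega> w (Suc k)"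
proof -
  have [measurable]: "x \<in> borel_measurable (past \<Omega> w (Suc k))"
    using x by (auto simp: l2_past_def intro: measurable_past_mono)
  have [measurable]: "w k \<in> borel_measurable (past \<Omega> w (Suc k))"
    by (rule noise_measurable_past) simp
  have "(\<lambda>\<omega>. A *v x \<omega> + w k \<omega> *\<^sub>R (B *v x \<omega>)) \<in> borel_measurable (past \<Omega> w (Suc k))"
    by measurable
  then show ?thesis
    using integrable_quadratic_form_step[OF x, of A B "mat 1"]
    by (simp add: l2_past_def power2_norm_eq_inner)
qed

lemma state_in_l2_past:
  assumes "\<xi> \<in> l2_past \<Omega> w k"
  shows "state F G w k \<xi> (k + n) \<in> l2_past \<Omega> w (k + n)"
proof (induction n)
  case 0
  show ?case
    using assms by simp
next
  case (Suc n)
  then show ?case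
    using l2_past_step[OF Suc, of "F (k + n)" "G (k + n)"] by simp
qed

end

section \<open>Exponential stability\<close>

lemma mean_sq_nonneg: "0 \<le> mean_sq \<Omega> x"
  by (simp add: mean_sq_def)

theorem theorem2p2p2:
  fixes \<Omega> :: "'a measure" and w :: "nat \<Rightarrow> 'a \<Rightarrow> real"
    and F G P :: "nat \<Rightarrow> real^'n^'n" and H :: "nat \<Rightarrow> real^'n^'m" and M :: real
  assumes "white_noise \<Omega> w"
    and "uniformly_detectable \<Omega> w F G H"
    and "0 < M"
    and "\<And>k. onorm ((*v) (F k)) \<le> M"
    and "\<And>k. onorm ((*v) (G k)) \<le> M"
    and "bounded (range P)"
    and "\<And>k. transpose (P k) = P k"
    and "\<And>k. nonneg_definite (P k)"
    and "\<And>k. - P k + transpose (F k) ** P (k + 1) ** F k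
                + transpose (G k) ** P (k + 1) ** G k + transpose (H k) ** H k = 0"
  shows "ESMS \<Omega> w F G"
proof -
  interpret white_noise \<Omega> w by fact
  obtain s t d b where d: "0 \<le> d" "d < 1" and b: "0 < b"
    and detect: "\<And>k \<xi>. \<xi> \<in> l2_past \<Omega> w k \<Longrightarrow>
      d\<^sup>2 * mean_sq \<Omega> \<xi> \<le> mean_sq \<Omega> (state F G w k \<xi> (k + t)) \<Longrightarrow>
      b\<^sup>2 * mean_sq \<Omega> \<xi> \<le> (\<Sum>i=k..k+s. mean_sq \<Omega> (sys_output F G H w k \<xi> i))"
    using assms(2) unfolding uniformly_detectable_def by blast
  obtain B where B: "\<And>k. onorm ((*v) (P k)) \<le> B"
    using bounded_range_onorm_matrix[OF assms(6)] by blast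
  define K where "K = 2 * M\<^sup>2"
  define c where "c = K ^ t / b\<^sup>2"
  (* The quotient may be smaller than 1; the maximum with 2 makes C admissible as the
     overshoot and keeps the decay rate 1 - 1 / C strictly between 0 and 1. *)
  define C where "C = max 2 (((\<Sum>j<t. K ^ j) + c * real (Suc s) * B) / (1 - d\<^sup>2))"
  have "0 \<le> K" "0 \<le> c" "2 \<le> C"
    by (simp_all add: K_def c_def C_def)
  have d2: "0 \<le> d\<^sup>2" "d\<^sup>2 < 1"
    using d by (simp_all add: power_less_one_iff abs_square_less_1)
  have decay: "mean_sq \<Omega> (state F G w k \<xi> (k + n)) \<le> C * mean_sq \<Omega> \<xi> * (1 - 1 / C) ^ n"
    if \<xi>: "\<xi> \<in> l2_past \<Omega> w k" for k n \<xi>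
  proof -
    define x where "x n = state F G w k \<xi> (k + n)" for n
    define X where "X n = mean_sq \<Omega> (x n)" for n
    define Y where "Y n = mean_sq \<Omega> (\<lambda>\<omega>. H (k + n) *v x n \<omega>)" for n
    define V where "V n = expectation (\<lambda>\<omega>. x n \<omega> \<bullet> (P (k + n) *v x n \<omega>))" for n
    have x: "x n \<in> l2_past \<Omega> w (k + n)" for n
      unfolding x_def using \<xi> by (rule state_in_l2_past)
    have sq: "integrable \<Omega> (\<lambda>\<omega>. (norm (x n \<omega>))\<^sup>2)" for n
      using x[of n] by (simp add: l2_past_def)
    have x_Suc: "x (Suc n) = (\<lambda>\<omega>. F (k + n) *v x n \<omega> + w (k + n) \<omega> *\<^sub>R (G (k + n) *v x n \<omega>))" for n
      by (simp add: x_def)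
    have X_nonneg: "0 \<le> X n" and Y_nonneg: "0 \<le> Y n" for n
      by (simp_all add: X_def Y_def mean_sq_nonneg)
    have V_nonneg: "0 \<le> V n" for n
      unfolding V_def using assms(8)[of "k + n"]
      by (intro Bochner_Integration.integral_nonneg) (simp add: nonneg_definite_def)
    have V_le: "V n \<le> B * X n" for n
    proof -
      have "V n \<le> expectation (\<lambda>\<omega>. B * (norm (x n \<omega>))\<^sup>2)"
        unfolding V_def
      proof (rule integral_mono)
        fix \<omega>
        show "x n \<omega> \<bullet> (P (k + n) *v x n \<omega>) \<le> B * (norm (x n \<omega>))\<^sup>2"
          using quadratic_form_le_onorm[of "x n \<omega>" "P (k + n)"]
            mult_right_mono[OF B[of "k + n"], of "(norm (x n \<omega>))\<^sup>2"] by simp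
      qed (auto intro: integrable_quadratic_form[OF x] simp: sq)
      then show ?thesis
        by (simp add: X_def mean_sq_def)
    qed
    have growth: "X (Suc n) \<le> K * X n" for n
    proof -
      have "X (Suc n) = expectation (\<lambda>\<omega>. x n \<omega> \<bullet> ((transpose (F (k + n)) ** F (k + n)
          + transpose (G (k + n)) ** G (k + n)) *v x n \<omega>))"
        using expectation_quadratic_form_step[OF x[of n], of "F (k + n)" "G (k + n)" "mat 1"]
        by (simp add: X_def mean_sq_def x_Suc power2_norm_eq_inner)
      also have "\<dots> \<le> expectation (\<lambda>\<omega>. K * (norm (x n \<omega>))\<^sup>2)"
      proof (rule integral_mono)
        fix \<omega>
        have "(norm (F (k + n) *v x n \<omega>))\<^sup>2 \<le> (M * norm (x n \<omega>))\<^sup>2"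
          "(norm (G (k + n) *v x n \<omega>))\<^sup>2 \<le> (M * norm (x n \<omega>))\<^sup>2"
          by (intro power_mono norm_matrix_vector_mult_le assms norm_ge_zero)+
        then show "x n \<omega> \<bullet> ((transpose (F (k + n)) ** F (k + n)
          + transpose (G (k + n)) ** G (k + n)) *v x n \<omega>) \<le> K * (norm (x n \<omega>))\<^sup>2"
          by (simp add: K_def matrix_vector_mult_add_rdistrib inner_add_right power_mult_distrib
              power2_norm_eq_inner flip: inner_matrix_vector_mult_both)
      qed (auto intro: integrable_quadratic_form[OF x] simp: sq)
      also have "\<dots> = K * X n"
        by (simp add: X_def mean_sq_def)
      finally show ?thesis .
    qed
    have dissipation: "V n - V (Suc n) = Y n" for n
    proof -
      let ?L = "transpose (F (k + n)) ** P (k + n + 1) ** F (k + n)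
          + transpose (G (k + n)) ** P (k + n + 1) ** G (k + n)"
      have P: "P (k + n) - ?L = transpose (H (k + n)) ** H (k + n)"
        using assms(9)[of "k + n"] by (simp add: algebra_simps)
      have "V n - V (Suc n) = V n - expectation (\<lambda>\<omega>. x n \<omega> \<bullet> (?L *v x n \<omega>))"
        using expectation_quadratic_form_step[OF x[of n], of "F (k + n)" "G (k + n)" "P (k + n + 1)"]
        by (simp add: V_def x_Suc)
      also have "\<dots> = expectation (\<lambda>\<omega>. x n \<omega> \<bullet> ((P (k + n) - ?L) *v x n \<omega>))"
        unfolding V_def matrix_vector_mult_diff_rdistrib inner_diff_right
        by (rule Bochner_Integration.integral_diff[symmetric])
          (rule integrable_quadratic_form[OF x])+
      also have "\<dots> = Y n"
        unfolding P Y_def mean_sq_def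
        by (simp add: power2_norm_eq_inner flip: inner_matrix_vector_mult_both)
      finally show ?thesis .
    qed
    have detect': "X (n + t) \<le> d\<^sup>2 * X n + c * (\<Sum>i\<le>s. Y (n + i))" for n
    proof (cases "d\<^sup>2 * X n \<le> X (n + t)")
      case False
      then show ?thesis
        using \<open>0 \<le> c\<close> sum_nonneg[of "{..s}" "\<lambda>i. Y (n + i)"] Y_nonneg
        by (smt (verit) mult_nonneg_nonneg)
    next
      case True
      have restart: "state F G w (k + n) (x n) (k + n + j) = x (n + j)" for j
        unfolding x_def state_restart by (simp add: add.assoc)
      have "b\<^sup>2 * X n \<le> (\<Sum>i=k+n..k+n+s. mean_sq \<Omega> (sys_output F G H w (k + n) (x n) i))"
        unfolding X_def using True x by (intro detect) (simp_all add: restart X_def)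
      also have "\<dots> = (\<Sum>i\<le>s. Y (n + i))"
      proof -
        have "mean_sq \<Omega> (sys_output F G H w (k + n) (x n) (i + (k + n))) = Y (n + i)" for i
          using restart[of i] by (simp add: Y_def sys_output_def add_ac)
        then show ?thesis
          using sum.shift_bounds_cl_nat_ivl[of
              "\<lambda>i. mean_sq \<Omega> (sys_output F G H w (k + n) (x n) i)" 0 "k + n" s]
          by (simp add: atLeast0AtMost add.commute[of s])
      qed
      finally have "X n \<le> (\<Sum>i\<le>s. Y (n + i)) / b\<^sup>2"
        using b by (simp add: field_simps)
      moreover have "X (n + t) \<le> K ^ t * X n"
      proof (induction t)
        case (Suc t)
        then show ?case
          using growth[of "n + t"] mult_left_mono[OF Suc \<open>0 \<le> K\<close>] by (simp add: mult_ac)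
      qed simp
      ultimately have "X (n + t) \<le> c * (\<Sum>i\<le>s. Y (n + i))"
        using mult_left_mono[of "X n" _ "K ^ t"] \<open>0 \<le> K\<close> by (fastforce simp: c_def)
      then show ?thesis
        using d2 X_nonneg[of n] by (smt (verit) mult_nonneg_nonneg)
    qed
    have "(\<Sum>j<N. X (n + j)) \<le> C * X n" for n N
    proof -
      have "(\<Sum>j<N. X (n + j)) \<le> ((\<Sum>j<t. K ^ j) + c * real (Suc s) * B) / (1 - d\<^sup>2) * X n"
        using d2(2) \<open>0 \<le> c\<close> \<open>0 \<le> K\<close> X_nonneg growth V_nonneg V_le Y_nonneg dissipation detect'
        by (rule tail_sums_bounded_if_detectable)
      also have "\<dots> \<le> C * X n"
        unfolding C_def by (intro mult_right_mono X_nonneg) simp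
      finally show ?thesis .
    qed
    then have "X n \<le> C * X 0 * (1 - 1 / C) ^ n"
      using \<open>2 \<le> C\<close> by (intro decay_if_tail_sums_bounded) auto
    then show ?thesis
      by (simp add: X_def x_def)
  qed
  show ?thesis
    unfolding ESMS_def
  proof (rule exI[of _ C], rule exI[of _ "1 - 1 / C"], intro conjI allI impI ballI)
    fix k0 k and \<xi> :: "'a \<Rightarrow> real^'n"
    assume "k0 \<le> k" "\<xi> \<in> l2_past \<Omega> w k0"
    then show "mean_sq \<Omega> (state F G w k0 \<xi> k) \<le> C * mean_sq \<Omega> \<xi> * (1 - 1 / C) ^ (k - k0)"
      using decay[of \<xi> k0 "k - k0"] by simp
  qed (use \<open>2 \<le> C\<close> in auto)
qed

end
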